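(* Let $p$ be a prime congruent to $7, 11, 13, 17, 19$ or $23$ modulo $24$, and let $j$ be an integer with $0\leq j\leq p-1$ and $j\neq \lfloor 5p/24\rfloor$. Then for all integers $n\geq 0$, $$b_6\left(p^2 n+pj+\alpha_p\right)\equiv 0\pmod 3.$$
   Context: A partition is called $6$-regular if none of its parts is divisible by $6$; $b_6(n)$ denotes the number of $6$-regular partitions of $n$ (with $b_6(0)=1$). For a prime $p\geq 5$, $\alpha_p$ denotes the residue in $\{0,1,\dots,p-1\}$ of the integer $5\,\frac{p^2-1}{24}$ modulo $p$. *)

theory Defs
  imports "HOL-Number_Theory.Number_Theory" "HOL-Library.Multiset"
begin

definition partitions :: "nat \<Rightarrow> nat multiset set" where
  "partitions n = {P. 0 \<notin># P \<and> sum_mset P = n}"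

definition regular_partition :: "nat \<Rightarrow> nat multiset \<Rightarrow> bool" where
  "regular_partition l P \<longleftrightarrow> (\<forall>k\<in>#P. \<not> l dvd k)"

definition num_regular_partitions :: "nat \<Rightarrow> nat \<Rightarrow> nat" where
  "num_regular_partitions l n = card {P \<in> partitions n. regular_partition l P}"

abbreviation b6 :: "nat \<Rightarrow> nat" where
  "b6 \<equiv> num_regular_partitions 6"

(* The inner division is exact: 24 divides p^2 - 1 for every prime p >= 5. *)
definition alpha :: "nat \<Rightarrow> nat" where
  "alpha p = (5 * ((p\<^sup>2 - 1) div 24)) mod p"

(* So num_regular_partitions never takes the default value of card on an infinite set. *)
lemma finite_partitions: "finite (partitions n)"
proof -
  have "P \<in> mset ` {xs. set xs \<subseteq> {..n} \<and> length xs \<le> n}" if P: "P \<in> partitions n" for P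
  proof -
    obtain xs where xs: "P = mset xs" by (metis ex_mset)
    have pos: "0 \<notin> set xs" and sum: "sum_list xs = n"
      using P by (auto simp: partitions_def xs sum_mset_sum_list)
    have "set xs \<subseteq> {..n}"
      using sum member_le_sum_list[of _ xs] by auto
    moreover have "length xs \<le> sum_list xs"
      using pos by (induction xs) auto
    ultimately show ?thesis using xs sum by auto
  qed
  then have "partitions n \<subseteq> mset ` {xs. set xs \<subseteq> {..n} \<and> length xs \<le> n}"
    by blast
  moreover have "finite (mset ` {xs. set xs \<subseteq> {..n} \<and> length xs \<le> n})"
    by (intro finite_imageI finite_lists_length_le finite_atMost)
  ultimately show ?thesis by (rule finite_subset)
qed

lemma b6_0: "b6 0 = 1"
proof -
  have "{P \<in> partitions 0. regular_partition 6 P} = {{#}}"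
    by (auto simp: partitions_def regular_partition_def)
       (metis multiset_nonemptyE)
  then show ?thesis by (simp add: num_regular_partitions_def)
qed

end

theory Submission
  imports Defs "HOL-Computational_Algebra.Formal_Power_Series"
begin

text \<open>
  Write $f_k = \prod_{i \ge 1} (1 - q^{ki})$. Modulo 3 the generating function of $b_6$ is
  $f_6 / f_1 \equiv f_2^3 / f_1$, and this quotient factors in two ways: as $f_1(-q) f_4$ and as
  $(f_2^2 / f_1) f_2$. By the Jacobi triple product, $f_1$ is supported on the exponents $i$ for which
  $24 i + 1$ is a square, and $f_2^2 / f_1$ on those for which $8 i + 1$ is a square. So if 3 does not
  divide $b_6(N)$, then $24 N + 5$ has both the form $z^2 + (2w)^2$ and the form $3 z^2 + 2 w^2$.
  For $N = p^2 n + p j + \alpha_p$ with $j \ne \lfloor 5p/24 \rfloor$ the prime $p$ divides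
  $24 N + 5$ exactly once. This contradicts the first form if $-1$ is a non-residue modulo $p$
  (residues 7, 11, 19, 23) and the second one if $-6$ is (residues 13, 17). Only the supports of the
  theta series matter: no cancellation between terms occurs.
\<close>

section \<open>The finite Jacobi triple product\<close>

definition qpoch :: "'a::comm_ring_1 \<Rightarrow> nat \<Rightarrow> 'a" where
  "qpoch q n = (\<Prod>i<n. 1 - q ^ Suc i)"

text \<open>The Gaussian binomial, given by a Pascal rule since a general commutative ring has no
  quotients of \<open>qpoch\<close> values.\<close>

fun qbinom :: "'a::comm_ring_1 \<Rightarrow> nat \<Rightarrow> nat \<Rightarrow> 'a" where
  "qbinom q n 0 = 1"
| "qbinom q 0 (Suc k) = 0"
| "qbinom q (Suc n) (Suc k) = qbinom q n k + q ^ Suc k * qbinom q n (Suc k)"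

lemma qpoch_0 [simp]: "qpoch q 0 = 1"
  by (simp add: qpoch_def)

lemma qpoch_Suc: "qpoch q (Suc n) = qpoch q n * (1 - q ^ Suc n)"
  by (simp add: qpoch_def)

lemma qbinom_eq_0: "n < k \<Longrightarrow> qbinom q n k = 0"
  by (induction q n k rule: qbinom.induct) auto

lemma qbinom_self [simp]: "qbinom q n n = 1"
  by (induction n) (auto simp: qbinom_eq_0)

text \<open>Multiplied by the denominators, the two terms of the Pascal rule become $1 - q^{k+1}$
  and $q^{k+1} (1 - q^{n-k})$ times \<open>qpoch q n\<close>; these factors add up to $1 -
  q^{n+1}$.\<close>

lemma qbinom_mult_qpoch:
  "k \<le> n \<Longrightarrow> qbinom q n k * (qpoch q k * qpoch q (n - k)) = qpoch q n"
proof (induction q n k rule: qbinom.induct)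
  case (3 q n k)
  show ?case
  proof (cases "k = n")
    case True
    then show ?thesis by (simp add: qbinom_eq_0)
  next
    case False
    with 3 have k: "k < n" by simp
    then obtain r where r: "n - k = Suc r" "n - Suc k = r" "n = Suc (k + r)"
      by (metis Suc_diff_Suc add_Suc_right le_add_diff_inverse less_imp_le_nat)
    have a: "qbinom q n k * (qpoch q k * qpoch q (Suc r)) = qpoch q n"
      using 3 k r by simp
    have b: "qbinom q n (Suc k) * (qpoch q (Suc k) * qpoch q r) = qpoch q n"
      using 3 k r by simp
    have "qbinom q (Suc n) (Suc k) * (qpoch q (Suc k) * qpoch q (Suc n - Suc k))
        = (1 - q ^ Suc k) * (qbinom q n k * (qpoch q k * qpoch q (Suc r)))
        + q ^ Suc k * (1 - q ^ Suc r) * (qbinom q n (Suc k) * (qpoch q (Suc k) * qpoch q r))"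
      using r by (simp add: qpoch_Suc algebra_simps)
    also have "\<dots> = qpoch q n * (1 - q ^ (Suc k + Suc r))"
      unfolding a b power_add by (simp add: algebra_simps)
    also have "Suc k + Suc r = Suc n" using r by simp
    finally show ?thesis by (simp add: qpoch_Suc)
  qed
qed auto

text \<open>The other Pascal rule. Away from the borders: expand by the defining one, apply the
  induction hypothesis to both terms and fold back.\<close>

lemma qbinom_Suc_Suc_alt:
  "k \<le> n \<Longrightarrow> qbinom q (Suc n) (Suc k) = q ^ (n - k) * qbinom q n k + qbinom q n (Suc k)"
proof (induction n arbitrary: k)
  case (Suc m)
  show ?case
  proof (cases k)
    case 0
    have "qbinom q (Suc m) (Suc 0) = q ^ m + qbinom q m (Suc 0)"
      using Suc.IH[of 0] by simp
    moreover have "qbinom q (Suc m) (Suc 0) = 1 + q * qbinom q m (Suc 0)"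
      by simp
    ultimately have "q * qbinom q (Suc m) (Suc 0) = q ^ Suc m + qbinom q (Suc m) (Suc 0) - 1"
      by (simp add: algebra_simps)
    then show ?thesis
      using 0 by (subst qbinom.simps(3)) (simp del: qbinom.simps(3))
  next
    case (Suc l)
    show ?thesis
    proof (cases "k = Suc m")
      case True
      then show ?thesis by (simp add: qbinom_eq_0)
    next
      case False
      with Suc.prems Suc have le: "l \<le> m" "Suc l \<le> m" by auto
      then obtain d where d: "m - l = Suc d" "m - Suc l = d" "m = Suc (l + d)"
        by (metis Suc_diff_Suc Suc_le_lessD add_Suc_right le_add_diff_inverse)
      have "qbinom q (Suc (Suc m)) (Suc k) = qbinom q (Suc m) k + q ^ Suc k * qbinom q (Suc m) (Suc k)"
        by simp
      also have "\<dots> = q ^ (m - l) * qbinom q m l + qbinom q m (Suc l)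
          + q ^ Suc k * (q ^ (m - k) * qbinom q m k + qbinom q m (Suc k))"
        using Suc.IH[OF le(1)] Suc.IH[OF le(2)] Suc by (simp del: qbinom.simps(3))
      also have "\<dots> = q ^ (Suc m - k) * qbinom q (Suc m) k + qbinom q (Suc m) (Suc k)"
        using Suc d by (simp add: algebra_simps power_add)
      finally show ?thesis .
    qed
  qed
qed auto

text \<open>Absorbs one more factor of the \<open>y\<close>-product in the triple product;
  \<open>sum_qbinom_Suc_alt\<close> does so for the \<open>x\<close>-product.\<close>

lemma sum_qbinom_Suc:
  "(\<Sum>r\<le>Suc n. qbinom q (Suc n) r * t r) = (\<Sum>r\<le>n. qbinom q n r * (q ^ r * t r + t (Suc r)))"
proof -
  have "(\<Sum>r\<le>n. qbinom q n r * (q ^ r * t r)) = t 0 + (\<Sum>r\<le>n. qbinom q n (Suc r) * (q ^ Suc r * t (Suc r)))"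
    using sum.atMost_Suc_shift[of "\<lambda>r. qbinom q n r * (q ^ r * t r)" n]
    by (simp add: qbinom_eq_0)
  then show ?thesis
    by (simp add: sum.atMost_Suc_shift sum.distrib algebra_simps del: sum.atMost_Suc)
qed

lemma sum_qbinom_Suc_alt:
  "(\<Sum>r\<le>Suc n. qbinom q (Suc n) r * t r) = (\<Sum>r\<le>n. qbinom q n r * (t r + q ^ (n - r) * t (Suc r)))"
proof -
  have "(\<Sum>r\<le>n. qbinom q n r * t r) = t 0 + (\<Sum>r\<le>n. qbinom q n (Suc r) * t (Suc r))"
    using sum.atMost_Suc_shift[of "\<lambda>r. qbinom q n r * t r" n]
    by (simp add: qbinom_eq_0)
  moreover have "(\<Sum>r\<le>n. qbinom q (Suc n) (Suc r) * t (Suc r)) =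
      (\<Sum>r\<le>n. (q ^ (n - r) * qbinom q n r + qbinom q n (Suc r)) * t (Suc r))"
    by (intro sum.cong) (auto simp: qbinom_Suc_Suc_alt simp del: qbinom.simps)
  ultimately show ?thesis
    by (simp add: sum.atMost_Suc_shift sum.distrib algebra_simps del: sum.atMost_Suc qbinom.simps(3))
qed

text \<open>
  Ramanujan's symmetric parametrisation by \<open>x\<close> and \<open>y\<close> with base \<open>q = x * y\<close>: both exponents are
  nonnegative for all integers \<open>k\<close>, so the identity holds in any commutative ring, without inverses.
\<close>
definition theta_term :: "'a::comm_ring_1 \<Rightarrow> 'a \<Rightarrow> int \<Rightarrow> 'a" where
  "theta_term x y k = x ^ nat (k * (k + 1) div 2) * y ^ nat (k * (k - 1) div 2)"

lemma theta_term_exponents: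
  fixes k :: int
  shows "2 * int (nat (k * (k + 1) div 2)) = k * (k + 1)"
    and "2 * int (nat (k * (k - 1) div 2)) = k * (k - 1)"
proof -
  have nonneg: "0 \<le> k * (k + 1)" "0 \<le> k * (k - 1)"
    by (auto simp: zero_le_mult_iff)
  have "even (k * (k + 1))" "even (k * (k - 1))" by auto
  then show "2 * int (nat (k * (k + 1) div 2)) = k * (k + 1)"
    and "2 * int (nat (k * (k - 1) div 2)) = k * (k - 1)"
    using nonneg by auto
qed

lemma theta_term_0 [simp]: "theta_term x y 0 = 1"
  by (simp add: theta_term_def)

lemma theta_term_commute: "theta_term x y k = theta_term y x (- k)"
  by (simp add: theta_term_def algebra_simps)

text \<open>Passing from \<open>k\<close> to \<open>k + 1\<close> changes the exponent of
  \<open>x\<close> by \<open>k + 1\<close> and that of \<open>y\<close> by \<open>k\<close>; the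
  surplus on the left is $m - k$ in both variables.\<close>

lemma theta_term_mult_left:
  assumes "k \<le> int m"
  shows "theta_term x y k * (x * (x * y) ^ m) = (x * y) ^ nat (int m - k) * theta_term x y (k + 1)"
proof -
  define a b a' b' where "a = nat (k * (k + 1) div 2)" and "b = nat (k * (k - 1) div 2)"
    and "a' = nat ((k + 1) * (k + 1 + 1) div 2)" and "b' = nat ((k + 1) * (k + 1 - 1) div 2)"
  note defs = this
  note e = theta_term_exponents[of k, folded defs] theta_term_exponents[of "k + 1", folded defs]
  have e': "a + Suc m = nat (int m - k) + a'" "b + m = nat (int m - k) + b'"
    using e assms by (simp_all add: nat_eq_iff algebra_simps)
  have "theta_term x y k * (x * (x * y) ^ m)
      = x ^ (a + Suc m) * y ^ (b + m)"
    by (simp add: theta_term_def defs power_mult_distrib power_add mult_ac)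
  also have "\<dots> = (x * y) ^ nat (int m - k) * theta_term x y (k + 1)"
    unfolding e' by (simp add: theta_term_def defs power_mult_distrib power_add mult_ac)
  finally show ?thesis .
qed

lemma theta_term_mult_right:
  assumes "- int n \<le> k"
  shows "theta_term x y k * (y * (x * y) ^ n) = (x * y) ^ nat (int n + k) * theta_term x y (k - 1)"
  using theta_term_mult_left[of "- k" n y x] assms
  by (simp add: theta_term_commute[of y x] mult.commute[of y x] add.commute)

text \<open>Induction on \<open>n\<close> with \<open>m = 0\<close>, then on \<open>m\<close>. A new
  factor turns each theta term into itself plus a power of \<open>x * y\<close> times a neighbour,
  and a Pascal rule merges the two sums.\<close>

theorem finite_jacobi_triple_product:
  "(\<Prod>i<m. 1 + x * (x * y) ^ i) * (\<Prod>i<n. 1 + y * (x * y) ^ i)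
     = (\<Sum>r\<le>m + n. qbinom (x * y) (m + n) r * theta_term x y (int r - int n))"
proof (induction m)
  case 0
  show ?case
  proof (induction n)
    case (Suc n)
    have "(\<Prod>i<0. 1 + x * (x * y) ^ i) * (\<Prod>i<Suc n. 1 + y * (x * y) ^ i) =
        (\<Sum>r\<le>n. qbinom (x * y) n r * (theta_term x y (int r - int n) * (1 + y * (x * y) ^ n)))"
      using Suc by (simp add: sum_distrib_right mult.assoc)
    also have "\<dots> = (\<Sum>r\<le>n. qbinom (x * y) n r * ((x * y) ^ r * theta_term x y (int r - int (Suc n))
         + theta_term x y (int (Suc r) - int (Suc n))))"
      by (intro sum.cong refl)
        (simp add: distrib_left theta_term_mult_right diff_diff_eq add.commute)
    also have "\<dots> = (\<Sum>r\<le>0 + Suc n. qbinom (x * y) (0 + Suc n) r * theta_term x y (int r - int (Suc n)))"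
      by (simp only: sum_qbinom_Suc add_0)
    finally show ?case .
  qed simp
next
  case (Suc m)
  have "(\<Prod>i<Suc m. 1 + x * (x * y) ^ i) * (\<Prod>i<n. 1 + y * (x * y) ^ i) =
      (\<Sum>r\<le>m + n. qbinom (x * y) (m + n) r * (theta_term x y (int r - int n) * (1 + x * (x * y) ^ m)))"
    by (simp only: prod.lessThan_Suc mult.assoc[symmetric] sum_distrib_right[symmetric] Suc[symmetric])
      (simp only: mult_ac)
  also have "\<dots> = (\<Sum>r\<le>m + n. qbinom (x * y) (m + n) r * (theta_term x y (int r - int n)
       + (x * y) ^ (m + n - r) * theta_term x y (int (Suc r) - int n)))"
  proof (intro sum.cong refl)
    fix r assume "r \<in> {..m + n}"
    then have "int r - int n \<le> int m" "nat (int m - (int r - int n)) = m + n - r"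
      "int r - int n + 1 = int (Suc r) - int n"
      by auto
    then show "qbinom (x * y) (m + n) r * (theta_term x y (int r - int n) * (1 + x * (x * y) ^ m))
        = qbinom (x * y) (m + n) r * (theta_term x y (int r - int n)
          + (x * y) ^ (m + n - r) * theta_term x y (int (Suc r) - int n))"
      by (simp only: distrib_left mult_1_right theta_term_mult_left)
  qed
  also have "\<dots> = (\<Sum>r\<le>Suc m + n. qbinom (x * y) (Suc m + n) r * theta_term x y (int r - int n))"
    by (simp only: sum_qbinom_Suc_alt add_Suc)
  finally show ?case .
qed

section \<open>Truncated congruences of power series\<close>

text \<open>For modulus 0 the coefficients agree exactly.\<close>
definition fps_cong :: "int \<Rightarrow> nat \<Rightarrow> int fps \<Rightarrow> int fps \<Rightarrow> bool" where
  "fps_cong m N f g \<longleftrightarrow> (\<forall>i<N. [fps_nth f i = fps_nth g i] (mod m))"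

lemma fps_cong_refl [simp]: "fps_cong m N f f"
  by (simp add: fps_cong_def)

lemma fps_cong_sym: "fps_cong m N f g \<Longrightarrow> fps_cong m N g f"
  by (simp add: fps_cong_def cong_sym)

lemma fps_cong_trans [trans]: "fps_cong m N f g \<Longrightarrow> fps_cong m N g h \<Longrightarrow> fps_cong m N f h"
  by (auto simp: fps_cong_def intro: cong_trans)

lemma fps_cong_diff: "fps_cong m N f g \<Longrightarrow> fps_cong m N f' g' \<Longrightarrow> fps_cong m N (f - f') (g - g')"
  by (simp add: fps_cong_def cong_diff)

lemma fps_cong_mult: "fps_cong m N f g \<Longrightarrow> fps_cong m N f' g' \<Longrightarrow> fps_cong m N (f * f') (g * g')"
  by (auto simp: fps_cong_def fps_mult_nth intro!: cong_sum cong_mult)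

lemma fps_cong_sum: "(\<And>a. a \<in> A \<Longrightarrow> fps_cong m N (f a) (g a)) \<Longrightarrow> fps_cong m N (sum f A) (sum g A)"
  by (auto simp: fps_cong_def fps_sum_nth intro!: cong_sum)

lemma fps_cong_prod: "(\<And>a. a \<in> A \<Longrightarrow> fps_cong m N (f a) (g a)) \<Longrightarrow> fps_cong m N (prod f A) (prod g A)"
  by (induction A rule: infinite_finite_induct) (auto intro: fps_cong_mult)

lemma fps_cong_imp_dvd_iff:
  "fps_cong m N f g \<Longrightarrow> i < N \<Longrightarrow> m dvd fps_nth f i \<longleftrightarrow> m dvd fps_nth g i"
  by (simp add: fps_cong_def cong_dvd_iff)

text \<open>A constant term 1 makes \<open>f\<close> a unit among the integer power series.\<close>

lemma fps_cong_cancel_left: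
  assumes "fps_nth f 0 = 1" and "fps_cong m N (f * g) (f * h)"
  shows "fps_cong m N g h"
proof -
  obtain u where u: "u * f = 1"
    using fps_left_inverse[of 1 f] assms(1) by auto
  have "fps_cong m N (u * (f * g)) (u * (f * h))"
    by (rule fps_cong_mult[OF fps_cong_refl assms(2)])
  then show ?thesis by (simp add: u mult.assoc[symmetric])
qed

lemma fps_cong_multiple_0:
  assumes "fps_X ^ N dvd f" shows "fps_cong m N f 0"
  using assms by (auto simp: fps_cong_def fps_X_power_mult_nth elim!: dvdE)

lemma fps_nth_qpoch_0:
  fixes q :: "'a::comm_ring_1 fps"
  assumes "fps_nth q 0 = 0" shows "fps_nth (qpoch q n) 0 = 1"
  using assms by (induction n) (auto simp: qpoch_Suc)

text \<open>Factors beyond the \<open>N\<close>-th are 1 up to multiples of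
  \<open>fps_X ^ N\<close>, so any product of length at least \<open>N\<close> stands in for the
  infinite one.\<close>

lemma fps_cong_qpoch:
  assumes "fps_X dvd q" and "N \<le> n" and "N \<le> n'"
  shows "fps_cong m N (qpoch q n) (qpoch q n')"
proof -
  have "fps_cong m N (qpoch q (N + d)) (qpoch q N)" for d
  proof (induction d)
    case (Suc d)
    have "fps_X ^ N dvd q ^ Suc (N + d)"
      using dvd_power_same[OF assms(1), of "Suc (N + d)"] le_imp_power_dvd[of N "Suc (N + d)" fps_X]
      by (meson dvd_trans le_add1 le_SucI)
    then have "fps_cong m N (1 - q ^ Suc (N + d)) (1 - 0)"
      by (intro fps_cong_diff fps_cong_multiple_0) auto
    from fps_cong_mult[OF Suc this] show ?case
      by (simp add: qpoch_Suc)
  qed simp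
  from this[of "n - N"] this[of "n' - N"] show ?thesis
    using assms by (metis fps_cong_sym fps_cong_trans le_add_diff_inverse)
qed

lemma fps_X_dvd_iff: "fps_X dvd f \<longleftrightarrow> fps_nth f 0 = 0"
  for f :: "'a::comm_ring_1 fps"
proof
  assume "fps_nth f 0 = 0"
  then have "f = fps_X * fps_shift 1 f"
    by (simp add: fps_eq_iff)
  then show "fps_X dvd f" by (rule dvdI)
qed (auto elim!: dvdE)

text \<open>Far from both ends the three \<open>qpoch\<close> values of the quotient formula agree
  below degree \<open>N\<close>, so one of them survives as a denominator.\<close>

lemma fps_cong_qbinom:
  assumes q: "fps_X dvd q" and "N \<le> k" "k + N \<le> n"
  shows "fps_cong m N (qbinom q n k * qpoch q N) 1"
proof -
  have P: "fps_cong m N (qpoch q N) (qpoch q r)" if "N \<le> r" for r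
    using fps_cong_qpoch[OF q] that by blast
  have "fps_cong m N (qbinom q n k * (qpoch q N * qpoch q N)) (qbinom q n k * (qpoch q k * qpoch q (n - k)))"
    using assms by (intro fps_cong_mult P) auto
  also have "qbinom q n k * (qpoch q k * qpoch q (n - k)) = qpoch q n"
    using assms by (intro qbinom_mult_qpoch) auto
  also have "fps_cong m N (qpoch q n) (qpoch q N)"
    using assms by (intro fps_cong_sym[OF P]) auto
  finally have "fps_cong m N (qpoch q N * (qbinom q n k * qpoch q N)) (qpoch q N * 1)"
    by (simp add: mult_ac)
  then show ?thesis
    by (rule fps_cong_cancel_left[rotated]) (use q in \<open>simp add: fps_nth_qpoch_0 fps_X_dvd_iff\<close>)
qed

section \<open>The support of a theta series\<close>

lemma theta_term_monomial:
  "theta_term (fps_const a * fps_X ^ s) (fps_const b * fps_X ^ t) k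
    = fps_const (theta_term a b k)
      * fps_X ^ (s * nat (k * (k + 1) div 2) + t * nat (k * (k - 1) div 2))"
  by (simp add: theta_term_def power_mult_distrib power_add power_mult fps_const_power mult_ac flip: fps_const_mult)

text \<open>Both halved products are at least $|k|(|k| - 1)/2$, hence at least \<open>N\<close>, and
  one of the weights \<open>s\<close>, \<open>t\<close> is positive.\<close>

lemma theta_exponent_ge:
  fixes k :: int
  assumes "0 < s + t" and "int N < \<bar>k\<bar>"
  shows "N \<le> s * nat (k * (k + 1) div 2) + t * nat (k * (k - 1) div 2)"
proof -
  have "2 * int N \<le> \<bar>k\<bar> * (\<bar>k\<bar> - 1)"
    using mult_mono[of 2 "\<bar>k\<bar>" "int N" "\<bar>k\<bar> - 1"] assms(2)
    by (cases "N = 0") auto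
  moreover have "\<bar>k\<bar> * (\<bar>k\<bar> - 1) \<le> k * (k + 1)" "\<bar>k\<bar> * (\<bar>k\<bar> - 1) \<le> k * (k - 1)"
    by (auto simp: abs_if algebra_simps)
  ultimately have "2 * int N \<le> 2 * int (nat (k * (k + 1) div 2))"
    "2 * int N \<le> 2 * int (nat (k * (k - 1) div 2))"
    unfolding theta_term_exponents by linarith+
  then have N: "N \<le> nat (k * (k + 1) div 2)" "N \<le> nat (k * (k - 1) div 2)"
    by linarith+
  show ?thesis
  proof (cases "s = 0")
    case True
    then show ?thesis using assms(1) mult_le_mono[OF _ N(2), of 1 t] by simp
  next
    case False
    then show ?thesis using mult_le_mono[OF _ N(1), of 1 s] by (simp add: trans_le_add1)
  qed
qed

text \<open>Multiplying by \<open>qpoch (x * y) N\<close> cancels the Gaussian binomials of the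
  finite identity and leaves a sum of monomials; a coefficient that is nonzero modulo
  \<open>m\<close> must sit at the exponent of one of them.\<close>

lemma jacobi_triple_product_support:
  fixes a b m :: int and s t N :: nat
  defines "x \<equiv> fps_const a * fps_X ^ s" and "y \<equiv> fps_const b * fps_X ^ t"
  assumes "0 < s + t" and "2 * N < M" "2 * N < M'" and "i < N"
    and coeff: "\<not> m dvd fps_nth ((\<Prod>i<M. 1 + x * (x * y) ^ i) * (\<Prod>i<M'. 1 + y * (x * y) ^ i) * qpoch (x * y) N) i"
  obtains k :: int where "2 * int i = int s * (k * (k + 1)) + int t * (k * (k - 1))"
proof -
  let ?q = "x * y"
  let ?e = "\<lambda>k. s * nat (k * (k + 1) div 2) + t * nat (k * (k - 1) div 2)"
  have q: "fps_X dvd ?q"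
    using assms(3) by (auto simp: fps_X_dvd_iff x_def y_def)
  have "fps_cong m N (qbinom ?q (M + M') r * theta_term x y (int r - int M') * qpoch ?q N)
      (theta_term x y (int r - int M'))" if "r \<le> M + M'" for r
  \<comment> \<open>Outer theta terms vanish below degree \<open>N\<close>. For the central ones,
    \<open>2 * N < M\<close> and \<open>2 * N < M'\<close> keep \<open>r\<close> at distance at
    least \<open>N\<close> from both ends.\<close>
  proof (cases "int N < \<bar>int r - int M'\<bar>")
    case True
    then have "fps_X ^ N dvd theta_term x y (int r - int M')"
      unfolding x_def y_def theta_term_monomial
      using theta_exponent_ge[OF assms(3) True] by (intro dvd_mult le_imp_power_dvd)
    then have z: "fps_cong m N (theta_term x y (int r - int M')) 0"
      by (rule fps_cong_multiple_0)
    have "fps_cong m N (qbinom ?q (M + M') r * theta_term x y (int r - int M') * qpoch ?q N)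
        (qbinom ?q (M + M') r * 0 * qpoch ?q N)"
      using z by (intro fps_cong_mult) auto
    then have "fps_cong m N (qbinom ?q (M + M') r * theta_term x y (int r - int M') * qpoch ?q N) 0"
      by (simp only: mult_zero_left mult_zero_right)
    then show ?thesis by (rule fps_cong_trans[OF _ fps_cong_sym[OF z]])
  next
    case False
    with assms have "N \<le> r" "r + N \<le> M + M'" by linarith+
    then have "fps_cong m N (theta_term x y (int r - int M') * (qbinom ?q (M + M') r * qpoch ?q N))
        (theta_term x y (int r - int M') * 1)"
      by (intro fps_cong_mult fps_cong_qbinom q) auto
    then show ?thesis by (simp add: mult_ac)
  qed
  then have "fps_cong m N ((\<Prod>i<M. 1 + x * ?q ^ i) * (\<Prod>i<M'. 1 + y * ?q ^ i) * qpoch ?q N)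
      (\<Sum>r\<le>M + M'. theta_term x y (int r - int M'))"
    unfolding finite_jacobi_triple_product sum_distrib_right by (intro fps_cong_sum) auto
  from fps_cong_imp_dvd_iff[OF this \<open>i < N\<close>] coeff
  have "\<not> m dvd fps_nth (\<Sum>r\<le>M + M'. theta_term x y (int r - int M')) i"
    by simp
  then have "\<exists>r. \<not> m dvd fps_nth (theta_term x y (int r - int M')) i"
    by (rule contrapos_np) (auto simp: fps_sum_nth intro!: dvd_sum)
  then obtain r where "fps_nth (theta_term x y (int r - int M')) i \<noteq> 0"
    by force
  then have "i = ?e (int r - int M')"
    by (simp add: x_def y_def theta_term_monomial split: if_splits)
  then have "2 * int i = int s * (2 * int (nat ((int r - int M') * (int r - int M' + 1) div 2)))
      + int t * (2 * int (nat ((int r - int M') * (int r - int M' - 1) div 2)))"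
    by simp
  then show ?thesis
    unfolding theta_term_exponents by (rule that)
qed

lemma prod_lessThan_triple: "(\<Prod>i<3 * n. f i) = (\<Prod>i<n. f (3 * i) * f (3 * i + 1) * f (3 * i + 2))"
  for f :: "nat \<Rightarrow> 'a::comm_monoid_mult"
  by (induction n) (auto simp: numeral_3_eq_3 mult_ac)

text \<open>Euler's product is the triple product with \<open>x = - u\<close> and \<open>y = - u\<^sup>2\<close>.\<close>
lemma qpoch_support:
  fixes c m :: int
  assumes "0 < d" and "i < N" "N \<le> n" and "\<not> m dvd fps_nth (qpoch (fps_const c * fps_X ^ d) n) i"
  obtains z :: int where "24 * int i + int d = int d * z\<^sup>2"
proof -
  define u where "u = fps_const c * fps_X ^ d"
  define M where "M = Suc (2 * N)"
  have x: "- u = fps_const (- c) * fps_X ^ d"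
    by (simp add: u_def flip: fps_const_neg)
  have y: "- u\<^sup>2 = fps_const (- c\<^sup>2) * fps_X ^ (2 * d)"
    by (simp add: u_def power_mult_distrib fps_const_power power_even_eq flip: fps_const_neg)
  have q: "- u * - u\<^sup>2 = u ^ 3"
    by (simp add: power2_eq_square power3_eq_cube)
  have u: "fps_X dvd u" "fps_X dvd u ^ 3"
    using assms(1) by (auto simp: fps_X_dvd_iff u_def)
  \<comment> \<open>Sorting the exponents modulo 3 yields the two products of the triple product and
    the factor with base \<open>u ^ 3\<close>.\<close>
  have pow: "u ^ Suc (3 * i) = u * (u ^ 3) ^ i" "u ^ Suc (3 * i + 1) = u\<^sup>2 * (u ^ 3) ^ i"
    "u ^ Suc (3 * i + 2) = (u ^ 3) ^ Suc i" for i
    by (simp_all add: power_mult power_add power2_eq_square power3_eq_cube)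
  let ?A = "(\<Prod>i<M. 1 + - u * (u ^ 3) ^ i) * (\<Prod>i<M. 1 + - u\<^sup>2 * (u ^ 3) ^ i)"
  have A: "qpoch u (3 * M) = ?A * qpoch (u ^ 3) M"
    unfolding qpoch_def prod_lessThan_triple pow by (simp add: prod.distrib)
  have "fps_cong m N (qpoch u n) (qpoch u (3 * M))"
    using assms by (intro fps_cong_qpoch u) (auto simp: M_def)
  moreover have "fps_cong m N (qpoch u (3 * M)) (?A * qpoch (u ^ 3) N)"
    unfolding A by (intro fps_cong_mult[OF fps_cong_refl] fps_cong_qpoch u) (auto simp: M_def)
  ultimately have "fps_cong m N (qpoch u n) (?A * qpoch (u ^ 3) N)"
    by (rule fps_cong_trans)
  from fps_cong_imp_dvd_iff[OF this \<open>i < N\<close>] assms(4)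
  have nz: "\<not> m dvd fps_nth ((\<Prod>i<M. 1 + - u * (- u * - u\<^sup>2) ^ i) * (\<Prod>i<M. 1 + - u\<^sup>2 * (- u * - u\<^sup>2) ^ i) * qpoch (- u * - u\<^sup>2) N) i"
    unfolding q by (simp only: u_def not_False_eq_True)
  obtain k :: int where "2 * int i = int d * (k * (k + 1)) + int (2 * d) * (k * (k - 1))"
  proof (rule jacobi_triple_product_support[of d "2 * d" N M M i m "- c" "- c\<^sup>2"])
    show "\<not> m dvd fps_nth ((\<Prod>i<M. 1 + fps_const (- c) * fps_X ^ d *
        (fps_const (- c) * fps_X ^ d * (fps_const (- c\<^sup>2) * fps_X ^ (2 * d))) ^ i) *
      (\<Prod>i<M. 1 + fps_const (- c\<^sup>2) * fps_X ^ (2 * d) *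
        (fps_const (- c) * fps_X ^ d * (fps_const (- c\<^sup>2) * fps_X ^ (2 * d))) ^ i) *
      qpoch (fps_const (- c) * fps_X ^ d * (fps_const (- c\<^sup>2) * fps_X ^ (2 * d))) N) i"
      using nz unfolding x y .
  qed (use assms in \<open>auto simp: M_def\<close>)
  \<comment> \<open>Here $2i = d (3k^2 - k)$; multiply by 12 and complete the square.\<close>
  then have "24 * int i + int d = int d * (6 * k - 1)\<^sup>2"
    by (simp add: power2_eq_square algebra_simps)
  then show ?thesis by (rule that)
qed

section \<open>The generating function of regular partitions\<close>

text \<open>Adjoining a part \<open>s\<close>: partitions containing \<open>s\<close> arise by
  adding \<open>s\<close> to a partition of \<open>n - s\<close>, so the new series times
  \<open>1 - fps_X ^ s\<close> is the old one.\<close>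

lemma partition_generating_function:
  assumes "finite S" and "0 \<notin> S"
  shows "Abs_fps (\<lambda>n. int (card {P. set_mset P \<subseteq> S \<and> sum_mset P = n})) * (\<Prod>s\<in>S. 1 - fps_X ^ s) = 1"
  using assms
proof (induction S)
  case empty
  have "{P. set_mset P \<subseteq> {} \<and> sum_mset P = n} = (if n = 0 then {{#}} else {})" for n :: nat
    by auto
  then show ?case
    by (simp add: fps_eq_iff)
next
  case (insert s S)
  define C where "C T n = {P. set_mset P \<subseteq> T \<and> sum_mset P = n}" for T and n :: nat
  have fin: "finite (C T n)" if "0 \<notin> T" for T n
    using that by (intro finite_subset[OF _ finite_partitions[of n]]) (auto simp: C_def partitions_def)
  have s: "0 < s" "0 \<notin> insert s S" using insert by auto
  have split: "C (insert s S) n = C S n \<union> add_mset s ` C (insert s S) (n - s)" if "s \<le> n" for n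
  proof (intro equalityI subsetI)
    fix P assume P: "P \<in> C (insert s S) n"
    show "P \<in> C S n \<union> add_mset s ` C (insert s S) (n - s)"
    proof (cases "s \<in># P")
      case True
      then obtain Q where "P = add_mset s Q" by (meson mset_add)
      with P show ?thesis by (auto simp: C_def)
    next
      case False
      with P show ?thesis by (auto simp: C_def)
    qed
  qed (use that in \<open>auto simp: C_def\<close>)
  have "card (C (insert s S) n) = card (C S n) + card (C (insert s S) (n - s))" if "s \<le> n" for n
    unfolding split[OF that]
  proof (subst card_Un_disjoint)
    show "C S n \<inter> add_mset s ` C (insert s S) (n - s) = {}"
    proof -
      have "s \<notin># P" if "P \<in> C S n" for P
        using that insert.hyps by (auto simp: C_def)
      moreover have "s \<in># P" if "P \<in> add_mset s ` C (insert s S) (n - s)" for P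
        using that by auto
      ultimately show ?thesis by blast
    qed
    show "card (C S n) + card (add_mset s ` C (insert s S) (n - s)) = card (C S n) + card (C (insert s S) (n - s))"
      by (subst card_image) (auto simp: inj_on_def)
  qed (use s fin in auto)
  moreover have "C (insert s S) n = C S n" if "n < s" for n
  proof -
    have "s \<notin># P" if "sum_mset P = n" for P
      using \<open>n < s\<close> that by (auto dest!: multi_member_split)
    then show ?thesis by (auto simp: C_def)
  qed
  ultimately have "Abs_fps (\<lambda>n. int (card (C (insert s S) n))) * (1 - fps_X ^ s)
      = Abs_fps (\<lambda>n. int (card (C S n)))"
    by (auto simp: fps_eq_iff right_diff_distrib fps_X_power_mult_right_nth)
  moreover have "(\<Prod>s\<in>insert s S. 1 - fps_X ^ s) = (1 - fps_X ^ s) * (\<Prod>s\<in>S. 1 - fps_X ^ s :: int fps)"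
    using insert.hyps by simp
  ultimately show ?case
    using insert.IH insert.prems by (simp only: C_def mult.assoc[symmetric]) simp
qed

lemma qpoch_split_multiples:
  assumes "0 < l"
  shows "qpoch q (l * n) = (\<Prod>i\<in>{i. 1 \<le> i \<and> i \<le> l * n \<and> \<not> l dvd i}. 1 - q ^ i) * qpoch (q ^ l) n"
proof -
  have S: "qpoch q k = (\<Prod>i\<in>{1..k}. 1 - q ^ i)" for q :: 'a and k
    unfolding qpoch_def using prod.atLeast1_atMost_eq[of "\<lambda>i. 1 - q ^ i" k] by simp
  have "qpoch (q ^ l) n = (\<Prod>i\<in>(*) l ` {1..n}. 1 - q ^ i)"
    using assms by (subst prod.reindex) (auto simp: S inj_on_def power_mult)
  moreover have "(*) l ` {1..n} = {i. 1 \<le> i \<and> i \<le> l * n \<and> l dvd i}"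
    using assms by (auto elim!: dvdE)
  moreover have "{1..l * n} = {i. 1 \<le> i \<and> i \<le> l * n \<and> \<not> l dvd i} \<union> {i. 1 \<le> i \<and> i \<le> l * n \<and> l dvd i}"
    by auto
  ultimately show ?thesis
    by (simp only: S) (subst prod.union_disjoint, auto)
qed

text \<open>Bounding the parts by \<open>l * K\<close> makes the product finite and changes no
  coefficient below that degree; the factors with index not divisible by \<open>l\<close> then
  cancel against the series.\<close>

lemma regular_partition_generating_function:
  assumes "0 < l"
  shows "fps_cong m (l * K) (Abs_fps (\<lambda>n. int (num_regular_partitions l n)) * qpoch fps_X (l * K))
    (qpoch (fps_X ^ l) K)"
proof -
  let ?S = "{i. 1 \<le> i \<and> i \<le> l * K \<and> \<not> l dvd i}"
  let ?G = "Abs_fps (\<lambda>n. int (card {P. set_mset P \<subseteq> ?S \<and> sum_mset P = n}))"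
  have "num_regular_partitions l n = card {P. set_mset P \<subseteq> ?S \<and> sum_mset P = n}" if "n < l * K" for n
  proof -
    have "k \<le> sum_mset P" if "k \<in># P" for k and P :: "nat multiset"
      using that by (auto dest!: multi_member_split)
    with that show ?thesis
      unfolding num_regular_partitions_def partitions_def regular_partition_def
      by (intro arg_cong[of _ _ card]) (fastforce simp: Suc_le_eq intro: gr0I)
  qed
  then have "fps_cong m (l * K) (Abs_fps (\<lambda>n. int (num_regular_partitions l n))) ?G"
    by (simp add: fps_cong_def)
  from fps_cong_mult[OF this fps_cong_refl]
  have "fps_cong m (l * K) (Abs_fps (\<lambda>n. int (num_regular_partitions l n)) * qpoch fps_X (l * K))
    (?G * qpoch fps_X (l * K))" .
  moreover have "?G * (\<Prod>i\<in>?S. 1 - fps_X ^ i) = 1"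
    by (rule partition_generating_function) auto
  ultimately show ?thesis
    unfolding qpoch_split_multiples[OF assms] by (simp add: mult.assoc[symmetric])
qed

section \<open>Two factorizations of the generating function modulo 3\<close>

lemma fps_cong_qpoch_cube: "fps_cong 3 N (qpoch (u ^ 3) n) (qpoch u n ^ 3)"
proof -
  have cube: "fps_cong 3 N (1 - v ^ 3) ((1 - v) ^ 3)" for v :: "int fps"
  proof -
    \<comment> \<open>Cubing is additive modulo 3; the error is three times $v - v^2$.\<close>
    have "(1 - v ^ 3) - (1 - v) ^ 3 = (v - v\<^sup>2) + (v - v\<^sup>2) + (v - v\<^sup>2)"
      by (simp add: power2_eq_square power3_eq_cube algebra_simps)
    then have "fps_nth (1 - v ^ 3) i - fps_nth ((1 - v) ^ 3) i = 3 * fps_nth (v - v\<^sup>2) i" for i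
      by (metis (no_types, lifting) fps_add_nth fps_sub_nth mult.commute mult_2_right distrib_left numeral_Bit1 numeral_One mult_1_right one_add_one)
    then show ?thesis by (simp add: fps_cong_def cong_iff_dvd_diff del: fps_sub_nth)
  qed
  have "fps_cong 3 N (1 - (u ^ 3) ^ k) ((1 - u ^ k) ^ 3)" for k
    using cube[of "u ^ k"] by (simp add: power_mult[symmetric] mult.commute)
  then show ?thesis
    unfolding qpoch_def prod_power_distrib by (intro fps_cong_prod)
qed

lemma qpoch_double: "qpoch u (2 * n) = qpoch (u\<^sup>2) n * (\<Prod>i<n. 1 - u * (u\<^sup>2) ^ i)"
proof (induction n)
  case (Suc n)
  have e: "u ^ Suc (2 * n) = u * (u\<^sup>2) ^ n" "u ^ Suc (Suc (2 * n)) = (u\<^sup>2) ^ Suc n"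
    by (simp_all add: power_mult power_mult_distrib power2_eq_square mult_ac)
  have "qpoch u (2 * Suc n) = qpoch u (2 * n) * (1 - u ^ Suc (2 * n)) * (1 - u ^ Suc (Suc (2 * n)))"
    by (simp only: mult_Suc_right add_2_eq_Suc qpoch_Suc)
  then show ?case
    unfolding e Suc qpoch_Suc prod.lessThan_Suc by (simp only: mult_ac)
qed simp

text \<open>Finite form of $f_1(q) f_1(-q) f_4 = f_2^3$: the odd factors pair up as $(1 -
  u^{2i+1})(1 + u^{2i+1}) = 1 - u^{4i+2}$, the odd factors for base $u^2$.\<close>

lemma qpoch_uminus:
  "qpoch u (2 * n) * qpoch (- u) (2 * n) * qpoch (u ^ 4) n = (qpoch (u\<^sup>2) n)\<^sup>2 * qpoch (u\<^sup>2) (2 * n)"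
proof -
  have "(\<Prod>i<n. 1 - u * (u\<^sup>2) ^ i) * (\<Prod>i<n. 1 - (- u) * ((- u)\<^sup>2) ^ i) = (\<Prod>i<n. 1 - u\<^sup>2 * ((u\<^sup>2)\<^sup>2) ^ i)"
    unfolding prod.distrib[symmetric]
    by (intro prod.cong refl) (simp add: algebra_simps power2_eq_square power_mult_distrib)
  then show ?thesis
    unfolding qpoch_double[of u] qpoch_double[of "- u"] qpoch_double[of "u\<^sup>2"]
    by (simp add: power2_eq_square mult_ac flip: power_mult) (simp add: mult_ac eval_nat_numeral)
qed

lemma fps_cong_regular6:
  "fps_cong 3 N (Abs_fps (\<lambda>n. int (b6 n)) * qpoch fps_X N) (qpoch (fps_X\<^sup>2) N ^ 3)"
proof -
  have "fps_cong 3 N (Abs_fps (\<lambda>n. int (b6 n)) * qpoch fps_X N) (Abs_fps (\<lambda>n. int (b6 n)) * qpoch fps_X (6 * N))"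
    by (intro fps_cong_mult fps_cong_qpoch) auto
  moreover have "fps_cong 3 N (Abs_fps (\<lambda>n. int (b6 n)) * qpoch fps_X (6 * N)) (qpoch (fps_X ^ 6) N)"
    using regular_partition_generating_function[of 6 3 N] by (simp add: fps_cong_def)
  moreover have "fps_cong 3 N (qpoch (fps_X ^ 6) N) (qpoch (fps_X\<^sup>2) N ^ 3)"
    using fps_cong_qpoch_cube[of N "fps_X\<^sup>2" N] by (simp flip: power_mult)
  ultimately show ?thesis by (blast intro: fps_cong_trans)
qed

text \<open>Compares \<open>fps_cong_regular6\<close> with \<open>qpoch_uminus\<close> and cancels
  $f_1$; the \<open>2 * N\<close> factors needed by the latter make no difference below degree
  \<open>N\<close>.\<close>

lemma fps_cong_regular6_pentagonal:
  "fps_cong 3 N (Abs_fps (\<lambda>n. int (b6 n))) (qpoch (- fps_X) N * qpoch (fps_X ^ 4) N)"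
proof (rule fps_cong_cancel_left)
  have "fps_cong 3 N (qpoch fps_X N * qpoch (- fps_X) N * qpoch (fps_X ^ 4) N)
      (qpoch fps_X (2 * N) * qpoch (- fps_X) (2 * N) * qpoch (fps_X ^ 4) N)"
    by (intro fps_cong_mult fps_cong_qpoch fps_cong_refl) auto
  also note qpoch_uminus
  also have "fps_cong 3 N ((qpoch (fps_X\<^sup>2) N)\<^sup>2 * qpoch (fps_X\<^sup>2) (2 * N)) ((qpoch (fps_X\<^sup>2) N)\<^sup>2 * qpoch (fps_X\<^sup>2) N)"
    by (intro fps_cong_mult fps_cong_qpoch fps_cong_refl) auto
  also have "(qpoch (fps_X\<^sup>2) N)\<^sup>2 * qpoch (fps_X\<^sup>2) N = (qpoch (fps_X\<^sup>2) N ^ 3 :: int fps)"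
    by (simp add: eval_nat_numeral)
  finally have "fps_cong 3 N (qpoch fps_X N * qpoch (- fps_X) N * qpoch (fps_X ^ 4) N) (qpoch (fps_X\<^sup>2) N ^ 3)" .
  from fps_cong_trans[OF fps_cong_regular6 fps_cong_sym[OF this]]
  show "fps_cong 3 N (qpoch fps_X N * Abs_fps (\<lambda>n. int (b6 n)))
      (qpoch fps_X N * (qpoch (- fps_X) N * qpoch (fps_X ^ 4) N))"
    by (simp only: mult_ac)
qed (simp add: fps_nth_qpoch_0)

lemma qpoch_plus: "qpoch u n * (\<Prod>i<n. 1 + u ^ Suc i) = qpoch (u\<^sup>2) n"
  unfolding qpoch_def prod.distrib[symmetric]
  by (intro prod.cong refl) (simp add: algebra_simps power2_eq_square power_mult_distrib)

text \<open>The factor 2 is the term \<open>1 + fps_X ^ 0\<close> of the first product.\<close>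
lemma fps_cong_regular6_triangular:
  assumes "2 * N < M"
  shows "fps_cong 3 N (2 * Abs_fps (\<lambda>n. int (b6 n)))
    ((\<Prod>i<Suc M. 1 + fps_X ^ i) * (\<Prod>i<M. 1 + fps_X ^ Suc i) * qpoch fps_X N * qpoch (fps_X\<^sup>2) N)"
proof (rule fps_cong_cancel_left)
  let ?Q = "\<Prod>i<M. 1 + fps_X ^ Suc i :: int fps"
  let ?P = "qpoch fps_X N :: int fps"
  let ?P2 = "qpoch (fps_X\<^sup>2) N :: int fps"
  \<comment> \<open>\<open>?Q\<close> stands for $f_2 / f_1$, so the right-hand side of the lemma,
    $2 Q^2 f_1 f_2$, is $2 f_2^3 / f_1$.\<close>
  have PQ: "fps_cong 3 N (?P * ?Q) ?P2"
  proof -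
    have "fps_cong 3 N (?P * ?Q) (qpoch fps_X M * ?Q)"
      using assms by (intro fps_cong_mult fps_cong_qpoch fps_cong_refl) auto
    also note qpoch_plus
    also have "fps_cong 3 N (qpoch (fps_X\<^sup>2) M) ?P2"
      using assms by (intro fps_cong_qpoch) auto
    finally show ?thesis .
  qed
  have "(\<Prod>i<Suc M. 1 + fps_X ^ i :: int fps) = 2 * ?Q"
    by (simp add: prod.lessThan_Suc_shift del: prod.lessThan_Suc)
  then have "?P * ((\<Prod>i<Suc M. 1 + fps_X ^ i) * ?Q * ?P * ?P2) = 2 * ((?P * ?Q) * (?P * ?Q) * ?P2)"
    by (simp only: mult_ac)
  also have "fps_cong 3 N \<dots> (2 * (?P2 * ?P2 * ?P2))"
    by (intro fps_cong_mult PQ fps_cong_refl)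
  also have "?P2 * ?P2 * ?P2 = ?P2 ^ 3"
    by (simp add: eval_nat_numeral)
  finally have S: "fps_cong 3 N (?P * ((\<Prod>i<Suc M. 1 + fps_X ^ i) * ?Q * ?P * ?P2)) (2 * ?P2 ^ 3)" .
  have "fps_cong 3 N (2 * (Abs_fps (\<lambda>n. int (b6 n)) * ?P)) (2 * ?P2 ^ 3)"
    by (rule fps_cong_mult[OF fps_cong_refl fps_cong_regular6])
  from fps_cong_trans[OF this fps_cong_sym[OF S]]
  show "fps_cong 3 N (?P * (2 * Abs_fps (\<lambda>n. int (b6 n))))
      (?P * ((\<Prod>i<Suc M. 1 + fps_X ^ i) * ?Q * ?P * ?P2))"
    by (simp only: mult_ac)
qed (simp add: fps_nth_qpoch_0)

section \<open>Quadratic forms forced by a coefficient not divisible by 3\<close>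

lemma not_dvd_fps_mult_nthE:
  fixes f g :: "int fps"
  assumes "\<not> m dvd fps_nth (f * g) n"
  obtains i j where "i + j = n" "\<not> m dvd fps_nth f i" "\<not> m dvd fps_nth g j"
proof -
  have "\<exists>i\<le>n. \<not> m dvd fps_nth f i * fps_nth g (n - i)"
    using assms by (rule contrapos_np) (auto simp: fps_mult_nth intro!: dvd_sum)
  then obtain i where "i \<le> n" "\<not> m dvd fps_nth f i * fps_nth g (n - i)"
    by blast
  then show ?thesis
    by (intro that[of i "n - i"]) auto
qed

text \<open>Some term of the convolution of $f_1(-q)$ and $f_4$ is nonzero modulo 3; its exponents
  satisfy $24i + 1 = z^2$ and $24j + 4 = 4w^2$, which add up to the claim.\<close>

lemma b6_sum_of_two_squares:
  assumes "\<not> 3 dvd b6 n"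
  obtains z w :: int where "24 * int n + 5 = z\<^sup>2 + (2 * w)\<^sup>2"
proof -
  have "\<not> 3 dvd int (b6 n)"
    using assms by presburger
  then have "\<not> (3::int) dvd fps_nth (qpoch (- fps_X) (Suc n) * qpoch (fps_X ^ 4) (Suc n)) n"
    using fps_cong_imp_dvd_iff[OF fps_cong_regular6_pentagonal, of n "Suc n"] by simp
  then obtain i j where ij: "i + j = n" "\<not> (3::int) dvd fps_nth (qpoch (- fps_X) (Suc n)) i"
    "\<not> (3::int) dvd fps_nth (qpoch (fps_X ^ 4) (Suc n)) j"
    by (rule not_dvd_fps_mult_nthE)
  obtain z :: int where z: "24 * int i + 1 = z\<^sup>2"
    using qpoch_support[of 1 i "Suc n" "Suc n" 3 "-1"] ij by (auto simp flip: fps_const_neg)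
  obtain w :: int where w: "24 * int j + 4 = 4 * w\<^sup>2"
    using qpoch_support[of 4 j "Suc n" "Suc n" 3 1] ij by auto
  show ?thesis
    using z w ij by (intro that[of z w]) (auto simp: power_mult_distrib)
qed

text \<open>The same for $2 f_2^2 / f_1$ and $f_2$: now $8i + 1 = z^2$, taken three times, and $24j
  + 2 = 2w^2$. The extra 2 is invertible modulo 3.\<close>

lemma b6_three_square_plus_two_square:
  assumes "\<not> 3 dvd b6 n"
  obtains z w :: int where "24 * int n + 5 = 3 * z\<^sup>2 + 2 * w\<^sup>2"
proof -
  define M where "M = 2 * Suc n + 1"
  have "\<not> 3 dvd 2 * int (b6 n)"
    using assms by presburger
  moreover have "fps_nth (2 * Abs_fps (\<lambda>n. int (b6 n))) n = 2 * int (b6 n)"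
    by (simp only: mult_2 fps_add_nth fps_nth_Abs_fps)
  ultimately have "\<not> (3::int) dvd fps_nth (2 * Abs_fps (\<lambda>n. int (b6 n))) n"
    by (simp only: not_False_eq_True)
  then have "\<not> (3::int) dvd fps_nth ((\<Prod>i<Suc M. 1 + fps_X ^ i) * (\<Prod>i<M. 1 + fps_X ^ Suc i)
      * qpoch fps_X (Suc n) * qpoch (fps_X\<^sup>2) (Suc n)) n"
    by (subst (asm) fps_cong_imp_dvd_iff[OF fps_cong_regular6_triangular[of "Suc n" M] lessI])
      (simp only: M_def less_add_one)
  then obtain i j where ij: "i + j = n"
    "\<not> (3::int) dvd fps_nth ((\<Prod>i<Suc M. 1 + fps_X ^ i) * (\<Prod>i<M. 1 + fps_X ^ Suc i) * qpoch fps_X (Suc n)) i"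
    "\<not> (3::int) dvd fps_nth (qpoch (fps_X\<^sup>2) (Suc n)) j"
    by (rule not_dvd_fps_mult_nthE)
  \<comment> \<open>Weights 0 and 1 mean \<open>x = 1\<close> and \<open>y = fps_X\<close>, so the
    exponents are triangular numbers.\<close>
  obtain k :: int where "2 * int i = int 0 * (k * (k + 1)) + int 1 * (k * (k - 1))"
  proof (rule jacobi_triple_product_support[of 0 1 "Suc n" "Suc M" M i 3 1 1])
    show "\<not> (3::int) dvd fps_nth
        ((\<Prod>i<Suc M. 1 + fps_const 1 * fps_X ^ 0 * (fps_const 1 * fps_X ^ 0 * (fps_const 1 * fps_X ^ 1)) ^ i) *
         (\<Prod>i<M. 1 + fps_const 1 * fps_X ^ 1 * (fps_const 1 * fps_X ^ 0 * (fps_const 1 * fps_X ^ 1)) ^ i) *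
         qpoch (fps_const 1 * fps_X ^ 0 * (fps_const 1 * fps_X ^ 1)) (Suc n)) i"
      using ij(2) by (simp only: fps_const_1_eq_1 power_0 power_one_right mult_1 power_Suc not_False_eq_True)
  qed (use ij in \<open>auto simp: M_def\<close>)
  then have z: "8 * int i + 1 = (2 * k - 1)\<^sup>2"
    by (simp add: power2_eq_square algebra_simps)
  obtain w :: int where w: "24 * int j + 2 = 2 * w\<^sup>2"
    using qpoch_support[of 2 j "Suc n" "Suc n" 3 1] ij by auto
  show ?thesis
    using z w ij by (intro that[of "2 * k - 1" w]) auto
qed

section \<open>Quadratic residues\<close>

text \<open>In Gauss's lemma the residues of \<open>2, 4, \<dots>, p - 1\<close> need no reduction.\<close>
lemma Legendre_2:
  assumes "prime p" and "p mod 4 = 1"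
  shows "Legendre 2 (int p) = (- 1) ^ ((p - 1) div 4)"
proof -
  have "p \<noteq> 0" "p \<noteq> 1" "p \<noteq> 2" using assms by auto
  then have p: "2 < p" by linarith
  interpret GAUSS p 2
    using assms p by unfold_locales (auto simp: cong_0_iff dest!: zdvd_imp_le)
  define h where "h = (p - 1) div 4"
  have "p = 4 * h + 1" using assms(2) p unfolding h_def by presburger
  then have ph: "int p = 4 * int h + 1" "(int p - 1) div 2 = 2 * int h"
    by simp_all
  have "C = (\<lambda>x. 2 * x) ` {0<..2 * int h}"
    unfolding C_def B_def A_def image_image ph(2) by (intro image_cong) (auto simp: ph(1))
  \<comment> \<open>\<open>E\<close> keeps the elements above $(p - 1)/2 = 2h$, the doubles of the
    numbers from $h + 1$ to $2h$.\<close>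
  then have "E = (\<lambda>x. 2 * x) ` {int h<..2 * int h}"
    unfolding E_def ph(2) by auto
  then have "card E = h"
    by (simp add: card_image inj_on_def)
  with gauss_lemma show ?thesis by (simp add: h_def)
qed

text \<open>As \<open>p\<close> is 1 modulo 4, reciprocity has no sign; and 1 is the only nonzero
  square modulo 3.\<close>

lemma Legendre_3:
  assumes "prime p" and "p mod 4 = 1" and "p mod 3 \<noteq> 0"
  shows "Legendre 3 (int p) = (if p mod 3 = 1 then 1 else - 1)"
proof -
  have "p \<noteq> 0" "p \<noteq> 1" "p \<noteq> 2" "p \<noteq> 3" using assms by auto
  then have p: "2 < p" "p \<noteq> 3" by linarith+
  have "even ((p - 1) div 2)" using assms(2) by presburger
  then have qr: "Legendre (int p) 3 * Legendre 3 (int p) = 1"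
    using Quadratic_Reciprocity[of p 3] assms(1) p by simp
  have r: "int p mod 3 = int (p mod 3)" by (simp add: zmod_int)
  have "Legendre (int p) 3 = (if p mod 3 = 1 then 1 else - 1)"
  proof (cases "p mod 3 = 1")
    case True
    then have "[1\<^sup>2 = int p] (mod 3)" by (simp add: cong_def r)
    then have "QuadRes 3 (int p)" unfolding QuadRes_def by blast
    with True r show ?thesis by (simp add: Legendre_def cong_def)
  next
    case False
    with assms(3) have p2: "int p mod 3 = 2" by (simp add: r)
    have "\<not> QuadRes 3 (int p)"
    proof
      assume "QuadRes 3 (int p)"
      then obtain y :: int where y: "y\<^sup>2 mod 3 = 2" by (auto simp: QuadRes_def cong_def p2)
      have "y mod 3 = 0 \<or> y mod 3 = 1 \<or> y mod 3 = 2" by presburger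
      with y show False by (auto simp: power_mod[of y 3 2, symmetric])
    qed
    with False p2 show ?thesis by (simp add: Legendre_def cong_def)
  qed
  with qr show ?thesis by (auto split: if_splits)
qed

text \<open>If \<open>y\<close> had an inverse \<open>v\<close> modulo \<open>p\<close>, then
  \<open>d\<close> would be the square of \<open>x * v\<close>; so \<open>p\<close> divides
  \<open>y\<close>, and then \<open>x\<close>.\<close>

lemma dvd_of_not_QuadRes:
  fixes x y d :: int
  assumes "prime p" and "\<not> QuadRes (int p) d" and "int p dvd x\<^sup>2 - d * y\<^sup>2"
  shows "int p dvd x" and "int p dvd y"
proof -
  have prime: "prime (int p)" using assms(1) by simp
  show "int p dvd y"
  proof (rule ccontr)
    assume "\<not> int p dvd y"
    then have "coprime y (int p)"
      using prime by (metis prime_imp_coprime coprime_commute)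
    then obtain v where v: "[y * v = 1] (mod int p)"
      using cong_solve_coprime_int by blast
    have "[x\<^sup>2 = d * y\<^sup>2] (mod int p)"
      using assms(3) by (simp add: cong_iff_dvd_diff)
    then have "[x\<^sup>2 * v\<^sup>2 = d * y\<^sup>2 * v\<^sup>2] (mod int p)"
      by (rule cong_scalar_right)
    then have "[(x * v)\<^sup>2 = d * (y * v)\<^sup>2] (mod int p)"
      by (simp add: power_mult_distrib mult.assoc)
    also have "[d * (y * v)\<^sup>2 = d * 1\<^sup>2] (mod int p)"
      by (intro cong_scalar_left cong_pow v)
    finally show False
      using assms(2) by (auto simp: QuadRes_def)
  qed
  then have "int p dvd d * y\<^sup>2" by (simp add: power2_eq_square)
  with assms(3) have "int p dvd x\<^sup>2"
    using dvd_add[of "int p" "x\<^sup>2 - d * y\<^sup>2" "d * y\<^sup>2"] by simp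
  then show "int p dvd x" using prime prime_dvd_power by blast
qed

text \<open>By Euler's criterion the power of a residue is congruent to 0 or 1, and neither is
  congruent to -1 when \<open>p\<close> exceeds 2.\<close>

lemma not_QuadRes_of_power:
  assumes "prime p" and "2 < p" and "[a ^ ((p - 1) div 2) = - 1] (mod int p)"
  shows "\<not> QuadRes (int p) a"
proof
  assume q: "QuadRes (int p) a"
  have ne: "\<not> [- 1 = e] (mod int p)" if "e = 0 \<or> e = 1" for e :: int
    using that assms(2) zdvd_imp_le[of "int p" 2] zdvd_imp_le[of "int p" 1]
    by (auto simp: cong_iff_dvd_diff)
  have "[- 1 = Legendre a (int p)] (mod int p)"
    using euler_criterion[OF assms(1,2), of a] assms(3) by (metis cong_sym cong_trans)
  with ne q show False
    by (auto simp: Legendre_def split: if_splits)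
qed

lemma not_QuadRes_minus_1:
  assumes "prime p" and "p mod 4 = 3"
  shows "\<not> QuadRes (int p) (- 1)"
proof (rule not_QuadRes_of_power)
  show "2 < p" using assms(2) by presburger
  have "odd ((p - 1) div 2)" using assms(2) by presburger
  then show "[(- 1) ^ ((p - 1) div 2) = - 1] (mod int p)" by simp
qed (fact assms(1))

text \<open>The sign disappears because $(p - 1)/2$ is even, leaving the symbols of 2 and 3. For 13
  only 2 is a non-residue, for 17 only 3.\<close>

lemma not_QuadRes_minus_6:
  assumes "prime p" and "p mod 24 \<in> {13, 17}"
  shows "\<not> QuadRes (int p) (- 6)"
proof (rule not_QuadRes_of_power)
  define q where "q = p div 24"
  have "p = 24 * q + 13 \<or> p = 24 * q + 17"
    using assms(2) unfolding q_def insert_iff empty_iff by presburger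
  then have m4: "p mod 4 = 1" and m3: "p mod 3 \<noteq> 0" and e: "even ((p - 1) div 2)"
    and m: "p mod 3 = 1 \<longleftrightarrow> odd ((p - 1) div 4)" and p: "2 < p"
    by (elim disjE; simp; presburger)+
  show "2 < p" by (rule p)
  have "(- 6 :: int) ^ ((p - 1) div 2) = 2 ^ ((p - 1) div 2) * 3 ^ ((p - 1) div 2)"
    using e by (simp flip: power_mult_distrib)
  moreover have "[Legendre 2 (int p) * Legendre 3 (int p) = 2 ^ ((p - 1) div 2) * 3 ^ ((p - 1) div 2)] (mod int p)"
    by (intro cong_mult euler_criterion assms(1) p)
  moreover have "Legendre 2 (int p) * Legendre 3 (int p) = - 1"
    using m by (auto simp: Legendre_2[OF assms(1) m4] Legendre_3[OF assms(1) m4 m3])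
  ultimately show "[(- 6) ^ ((p - 1) div 2) = - 1] (mod int p)"
    by (simp add: cong_sym)
qed (fact assms(1))

section \<open>The exact power of \<open>p\<close> in $24N + 5$\<close>

lemma alpha_shift:
  assumes "p mod 24 \<in> {7, 11, 13, 17, 19, 23}"
  shows "24 * int (p\<^sup>2 * n + p * j + alpha p) + 5
    = (int p)\<^sup>2 * (24 * int n + 5) + 24 * int p * (int j - int (5 * p div 24))"
proof -
  \<comment> \<open>The claim reduces to \<open>5 * s = p * t + alpha p\<close>: the excluded value
    \<open>t\<close> of \<open>j\<close> is also the quotient of \<open>5 * s\<close> by
    \<open>p\<close>.\<close>
  define s t r where "s = (p\<^sup>2 - 1) div 24" and "t = 5 * p div 24" and "r = 5 * p mod 24"
  have p24: "p mod 24 = 7 \<or> p mod 24 = 11 \<or> p mod 24 = 13 \<or> p mod 24 = 17 \<or> p mod 24 = 19 \<or> p mod 24 = 23"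
    using assms by simp
  then have p: "5 \<le> p" by presburger
  have "r = 5 * (p mod 24) mod 24" unfolding r_def by (rule mod_mult_right_eq[symmetric])
  then have "1 \<le> r" using p24 by (elim disjE) simp_all
  then have r: "1 \<le> r" "r < 24" "5 * p = 24 * t + r"
    unfolding r_def t_def by simp_all
  \<comment> \<open>Units modulo 24 square to 1, so the division defining \<open>s\<close> is
    exact.\<close>
  have "p\<^sup>2 mod 24 = (p mod 24)\<^sup>2 mod 24" by (simp add: power_mod)
  also have "\<dots> = 1" using p24 by (elim disjE) simp_all
  finally have "p\<^sup>2 mod 24 = 1" .
  then have "p\<^sup>2 = 24 * (p\<^sup>2 div 24) + 1"
    by (metis mult_div_mod_eq)
  then have "p\<^sup>2 = 24 * s + 1"
    unfolding s_def by (metis add_diff_cancel_right' nonzero_mult_div_cancel_left zero_neq_numeral)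
  then have s: "24 * int s = (int p)\<^sup>2 - 1"
    by (simp flip: of_nat_power)
  have "5 * (int p)\<^sup>2 = int p * int (5 * p)" by (simp add: power2_eq_square)
  also have "\<dots> = 24 * (int p * int t) + int p * int r" unfolding r(3) by (simp add: algebra_simps)
  finally have e: "24 * (5 * int s) = 24 * (int p * int t) + int p * int r - 5"
    using s by simp
  \<comment> \<open>Since $24 (5s - pt) = pr - 5$ and \<open>p\<close> is at least 5, these bounds
    place $5s - pt$ between 0 and $p - 1$.\<close>
  have "int p * 1 \<le> int p * int r" "int p * int r < int p * 24"
    using r p by (simp_all add: mult_left_mono)
  with e p have "int p * int t \<le> 5 * int s" "5 * int s < int p * int t + int p"
    by linarith+
  then have "p * t \<le> 5 * s" "5 * s < p * Suc t"
    by (simp_all add: algebra_simps flip: of_nat_mult of_nat_add)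
  then have "5 * s div p = t"
    by (intro div_nat_eqI) (simp_all add: mult.commute)
  then have "5 * s = p * t + alpha p"
    unfolding alpha_def s_def[symmetric] by (metis mult_div_mod_eq)
  then have "5 * int s = int p * int t + int (alpha p)"
    by (metis of_nat_add of_nat_mult of_nat_numeral)
  with s show ?thesis
    unfolding t_def[symmetric] by (simp add: algebra_simps)
qed

theorem corollary1p2:
  fixes p j n :: nat
  assumes "prime p"
    and "p mod 24 \<in> {7, 11, 13, 17, 19, 23}"
    and "j \<le> p - 1"
    and "j \<noteq> (5 * p) div 24"
  shows "[b6 (p\<^sup>2 * n + p * j + alpha p) = 0] (mod 3)"
proof (rule ccontr)
  define N where "N = p\<^sup>2 * n + p * j + alpha p"
  define d where "d = int j - int (5 * p div 24)"
  assume "\<not> [b6 (p\<^sup>2 * n + p * j + alpha p) = 0] (mod 3)"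
  then have b: "\<not> 3 dvd b6 N" by (simp add: cong_0_iff N_def)
  have prime: "prime (int p)" using assms(1) by simp
  have eq: "24 * int N + 5 = (int p)\<^sup>2 * (24 * int n + 5) + 24 * int p * d"
    using alpha_shift[OF assms(2)] by (simp add: N_def d_def)
  then have dvd: "int p dvd 24 * int N + 5"
    by (simp add: power2_eq_square)
  have p24: "p mod 24 = 7 \<or> p mod 24 = 11 \<or> p mod 24 = 13 \<or> p mod 24 = 17 \<or> p mod 24 = 19 \<or> p mod 24 = 23"
    using assms(2) by simp
  then have "5 < p" by presburger
  then have "int p \<noteq> 0" by simp
  \<comment> \<open>The term \<open>24 * int p * d\<close> has only one factor \<open>p\<close>,
    because \<open>d\<close> is nonzero and smaller than \<open>p\<close> in absolute value.\<close>
  have not_dvd: "\<not> (int p)\<^sup>2 dvd 24 * int N + 5"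
  proof
    assume "(int p)\<^sup>2 dvd 24 * int N + 5"
    then have "(int p)\<^sup>2 dvd 24 * int p * d"
      unfolding eq by (simp add: dvd_add_right_iff)
    then have "int p dvd 24 * d"
      using \<open>int p \<noteq> 0\<close> by (simp add: power2_eq_square mult.left_commute[of 24] mult.assoc)
    moreover have "\<not> int p dvd 24"
    proof
      assume "int p dvd 24"
      then have "int p dvd 2 ^ 3 * 3" by simp
      then have "int p dvd 2 \<or> int p dvd 3"
        using prime by (metis prime_dvd_mult_iff prime_dvd_power)
      with \<open>5 < p\<close> show False by (auto dest: zdvd_imp_le)
    qed
    ultimately have "int p dvd d"
      using prime by (simp add: prime_dvd_mult_iff)
    moreover have "\<bar>d\<bar> < int p" "d \<noteq> 0"
      using assms(3,4) \<open>5 < p\<close> unfolding d_def by linarith+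
    ultimately show False
      using dvd_imp_le_int[of d "int p"] by simp
  qed
  \<comment> \<open>For a non-residue \<open>e\<close>, a prime \<open>p\<close> dividing $x^2 - e
    y^2$ divides \<open>x\<close> and \<open>y\<close>; whenever this puts $p^2$ into $24N + 5$,
    \<open>not_dvd\<close> is violated.\<close>
  have inert: False if "\<not> QuadRes (int p) e" "int p dvd x\<^sup>2 - e * y\<^sup>2"
    "\<And>k l. x = int p * k \<Longrightarrow> y = int p * l \<Longrightarrow> (int p)\<^sup>2 dvd 24 * int N + 5" for x y e
    using dvd_of_not_QuadRes[OF assms(1) that(1,2)] that(3) not_dvd by (auto elim!: dvdE)
  have "p mod 4 = 3 \<or> p mod 24 = 13 \<or> p mod 24 = 17"
    using p24 mod_mod_cancel[of 4 24 p] by (elim disjE) simp_all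
  then consider "p mod 4 = 3" | "p mod 24 \<in> {13, 17}"
    by auto
  then show False
  proof cases
    case 1
    obtain z w where zw: "24 * int N + 5 = z\<^sup>2 + (2 * w)\<^sup>2"
      using b6_sum_of_two_squares[OF b] .
    show False
    proof (rule inert[OF not_QuadRes_minus_1[OF assms(1) 1]])
      show "int p dvd z\<^sup>2 - (- 1) * (2 * w)\<^sup>2" using dvd zw by simp
      show "(int p)\<^sup>2 dvd 24 * int N + 5" if "z = int p * k" "2 * w = int p * l" for k l
        unfolding zw that by (simp add: power_mult_distrib)
    qed
  next
    case 2
    obtain z w where zw: "24 * int N + 5 = 3 * z\<^sup>2 + 2 * w\<^sup>2"
      using b6_three_square_plus_two_square[OF b] .
    have "\<not> int p dvd 3" using \<open>5 < p\<close> by (auto dest: zdvd_imp_le)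
    then have three: "coprime ((int p)\<^sup>2) 3"
      using prime_imp_coprime[OF prime, of 3] by simp
    show False
    proof (rule inert[OF not_QuadRes_minus_6[OF assms(1) 2]])
      \<comment> \<open>Multiplying by 3 turns the form into $(3z)^2 + 6w^2$; the 3, coprime to
        \<open>p\<close>, is removed at the end.\<close>
      have "(3 * z)\<^sup>2 - (- 6) * w\<^sup>2 = 3 * (24 * int N + 5)"
        unfolding zw by (simp add: power2_eq_square)
      with dvd show "int p dvd (3 * z)\<^sup>2 - (- 6) * w\<^sup>2"
        by (simp only: dvd_mult)
      show "(int p)\<^sup>2 dvd 24 * int N + 5" if "3 * z = int p * k" "w = int p * l" for k l
      proof -
        have "3 * (24 * int N + 5) = (3 * z)\<^sup>2 + 6 * w\<^sup>2"
          unfolding zw by (simp add: power2_eq_square)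
        also have "(int p)\<^sup>2 dvd \<dots>"
          unfolding that by (simp add: power_mult_distrib)
        finally show ?thesis
          by (simp only: coprime_dvd_mult_right_iff[OF three])
      qed
    qed
  qed
qed

end
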